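(* Let $\mathbb{A}$ be a commutative ring, let $(X,f)$ be an $\mathbb{A}$-weighted set, and let $G\subseteq S_m$ be a subgroup. Then the weighted cardinality of $X^{m}/^{orb}G$ is $$|X^{m}/^{orb}G|_{f}=P_{G}^{orb}\left(|X|_{f},|X|_{f^{2}},\dots\right).$$
   Context: An $\mathbb{A}$-weighted set is a pair $(X,f)$ with $X$ a finite set and $f:X\to\mathbb{A}$ any map; its cardinality is $|X|_f=\sum_{x\in X}f(x)$. The weight $f^{k}$ is the pointwise power, so $|X|_{f^k}=\sum_{x\in X}f(x)^k$. $S_m$ is the symmetric group on $[m]=\{1,\dots,m\}$. Identify $X^m$ with the set of maps $\alpha:[m]\to X$. $G\subseteq S_m$ acts on $X^m$ by permuting coordinates, $g\cdot\alpha=\alpha\circ g^{-1}$. The weight of $\alpha\in X^m$ is $\prod_{x\in[m]}f(\alpha(x))$. For a finite group $G$, $C(G)$ is the set of conjugacy classes of $G$, with a fixed representative $g$ for each class $\overline{g}$, and $|\overline{g}|$ is the number of elements of the class; $Z(g)$ is the centralizer of $g$ in $G$; and $P(G)=\{(\overline{g},h)\mid\overline{g}\in C(G),\ h\in Z(g)\}$. If $G$ acts on a weighted set $Y$ preserving weights, the orbiquotient is $Y/^{orb}G=\bigsqcup_{\overline{g}\in C(G)}Y^{g}/Z(g)$ with $Y^g=\{y\in Y\mid gy=y\}$, and the weight of an orbit in $Y^g/Z(g)$ is the weight of any of its elements; $|X^m/^{orb}G|_f$ is the sum of these weights for $Y=X^m$. For $g\in S_m$, $C(g)$ denotes the partition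 of $[m]$ into the cycles (orbits, including fixed points) of $g$. $\pi\vee\rho$ is the join of partitions: $i,j$ lie in the same block of $\pi\vee\rho$ iff there is a sequence $i=a_0,a_1,\dots,a_r=j$ such that consecutive terms lie in a common block of $\pi$ or in a common block of $\rho$. $b_k(\pi)$ is the number of blocks of $\pi$ of cardinality $k$. The orbicycle index polynomial of $G\subseteq S_m$ is $$P_{G}^{orb}(x_1,x_2,\dots)=\frac{1}{|G|}\sum_{(\overline{g},h)\in P(G)}|\overline{g}|\prod_{k\ge1}x_k^{b_k(C(g)\vee C(h))}\in\mathbb{Q}[x_1,x_2,\dots].$$
   Formalization: Since the polynomial has rational coefficients (1/|G|), its value is undefined in rings where |G| is not invertible; the equality is stated when |G| is a unit in A, and for every nonzero commutative ring with 1 in the form with both sides multiplied by |G|. *)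

theory Defs
  imports
    Complex_Main
    "HOL-Algebra.Group_Action"
    "HOL-Algebra.Sym_Groups"
    "HOL-Combinatorics.Orbits"
    "HOL-Library.Poly_Mapping"
begin

text \<open>Both HOL-Algebra and HOL-Combinatorics have a constant \<open>orbit\<close>; it is always
  written with its theory name below.\<close>

definition weighted_card :: "'x set \<Rightarrow> ('x \<Rightarrow> 'a::comm_ring_1) \<Rightarrow> 'a" where
  "weighted_card X f = (\<Sum>x\<in>X. f x)"


subsection \<open>Conjugacy classes and the orbiquotient\<close>

definition conj_classes :: "('g, 'r) monoid_scheme \<Rightarrow> 'g set set" where
  "conj_classes G = orbits G (carrier G) (\<lambda>h g. h \<otimes>\<^bsub>G\<^esub> g \<otimes>\<^bsub>G\<^esub> inv\<^bsub>G\<^esub> h)"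

definition centralizer :: "('g, 'r) monoid_scheme \<Rightarrow> 'g \<Rightarrow> 'g set" where
  "centralizer G g = {h \<in> carrier G. h \<otimes>\<^bsub>G\<^esub> g = g \<otimes>\<^bsub>G\<^esub> h}"

definition class_reps :: "('g, 'r) monoid_scheme \<Rightarrow> ('g set \<Rightarrow> 'g) \<Rightarrow> bool" where
  "class_reps G rep \<longleftrightarrow> (\<forall>c\<in>conj_classes G. rep c \<in> c)"

definition class_pairs :: "('g, 'r) monoid_scheme \<Rightarrow> ('g set \<Rightarrow> 'g) \<Rightarrow> ('g set \<times> 'g) set" where
  "class_pairs G rep = (SIGMA c : conj_classes G. centralizer G (rep c))"

definition orbiquotient ::
  "('g, 'r) monoid_scheme \<Rightarrow> ('g set \<Rightarrow> 'g) \<Rightarrow> 'y set \<Rightarrow> ('g \<Rightarrow> 'y \<Rightarrow> 'y) \<Rightarrow> ('g set \<times> 'y set) set" where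
  "orbiquotient G rep Y \<phi> =
     (SIGMA c : conj_classes G.
        orbits (G\<lparr>carrier := centralizer G (rep c)\<rparr>) (invariants Y \<phi> (rep c)) \<phi>)"

text \<open>The weight of an orbit is the weight of any of its elements. The choice below is
  immaterial when the action preserves the weight.\<close>

definition orbit_weight :: "('y \<Rightarrow> 'a) \<Rightarrow> 'g set \<times> 'y set \<Rightarrow> 'a" where
  "orbit_weight w q = w (SOME y. y \<in> snd q)"


subsection \<open>Permutation groups acting on powers\<close>

definition perm_group :: "nat \<Rightarrow> (nat \<Rightarrow> nat) set \<Rightarrow> (nat \<Rightarrow> nat) monoid" where
  "perm_group m H = (sym_group m)\<lparr>carrier := H\<rparr>"

definition power_set :: "'x set \<Rightarrow> nat \<Rightarrow> (nat \<Rightarrow> 'x) set" where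
  "power_set X m = {1..m} \<rightarrow>\<^sub>E X"

definition coord_action :: "(nat \<Rightarrow> nat) \<Rightarrow> (nat \<Rightarrow> 'x) \<Rightarrow> nat \<Rightarrow> 'x" where
  "coord_action g \<alpha> = \<alpha> \<circ> inv' g"

definition power_weight :: "nat \<Rightarrow> ('x \<Rightarrow> 'a::comm_ring_1) \<Rightarrow> (nat \<Rightarrow> 'x) \<Rightarrow> 'a" where
  "power_weight m f \<alpha> = (\<Prod>i\<in>{1..m}. f (\<alpha> i))"


subsection \<open>Partitions\<close>

definition cycle_partition :: "nat \<Rightarrow> (nat \<Rightarrow> nat) \<Rightarrow> nat set set" where
  "cycle_partition m g = Orbits.orbit g ` {1..m}"

definition same_block :: "'i set set \<Rightarrow> ('i \<times> 'i) set" where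
  "same_block \<pi> = {(i, j). \<exists>B\<in>\<pi>. i \<in> B \<and> j \<in> B}"

definition partition_join :: "'i set set \<Rightarrow> 'i set set \<Rightarrow> 'i set set" where
  "partition_join \<pi> \<rho> = (\<Union>\<pi> \<union> \<Union>\<rho>) // (same_block \<pi> \<union> same_block \<rho>)\<^sup>*"

definition blocks_of_size :: "nat \<Rightarrow> 'i set set \<Rightarrow> nat" where
  "blocks_of_size k \<pi> = card {B \<in> \<pi>. card B = k}"


subsection \<open>Polynomials in countably many variables and the orbicycle index\<close>

text \<open>A monomial is a finitely supported exponent function, a polynomial a finitely supported
  function from monomials to coefficients, with convolution as multiplication.\<close>

type_synonym rat_mpoly = "(nat \<Rightarrow>\<^sub>0 nat) \<Rightarrow>\<^sub>0 rat"

definition mp_const :: "rat \<Rightarrow> rat_mpoly" where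
  "mp_const r = Poly_Mapping.single 0 r"

definition mp_var :: "nat \<Rightarrow> rat_mpoly" where
  "mp_var k = Poly_Mapping.single (Poly_Mapping.single k 1) 1"

text \<open>The image of a rational \<open>a / b\<close> (in lowest terms) in a commutative ring in which \<open>b\<close> is
  invertible; it is unspecified otherwise. For integral \<open>r\<close> it is meaningful in every ring.\<close>

definition rat_scalar :: "rat \<Rightarrow> 'a::comm_ring_1" where
  "rat_scalar r = of_int (fst (quotient_of r)) * (THE u. of_int (snd (quotient_of r)) * u = 1)"

definition mp_eval :: "rat_mpoly \<Rightarrow> (nat \<Rightarrow> 'a::comm_ring_1) \<Rightarrow> 'a" where
  "mp_eval p v = (\<Sum>e\<in>Poly_Mapping.keys p.
     rat_scalar (Poly_Mapping.lookup p e) *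
     (\<Prod>k\<in>Poly_Mapping.keys e. v k ^ Poly_Mapping.lookup e k))"

text \<open>Blocks of a partition of \<open>{1..m}\<close> have size in \<open>{1..m}\<close>, so only these variables occur.\<close>

definition orbicycle_index ::
  "nat \<Rightarrow> (nat \<Rightarrow> nat) set \<Rightarrow> ((nat \<Rightarrow> nat) set \<Rightarrow> nat \<Rightarrow> nat) \<Rightarrow> rat_mpoly" where
  "orbicycle_index m H rep =
     mp_const (1 / of_nat (card H)) *
     (\<Sum>(c, h)\<in>class_pairs (perm_group m H) rep.
        of_nat (card c) *
        (\<Prod>k\<in>{1..m}. mp_var k ^
           blocks_of_size k (partition_join (cycle_partition m (rep c)) (cycle_partition m h))))"


subsection \<open>Rational scalars behave as expected\<close>

lemma rat_scalar_eqI: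
  fixes u :: "'a::comm_ring_1"
  assumes "of_int (snd (quotient_of r)) * u = 1"
  shows "rat_scalar r = of_int (fst (quotient_of r)) * u"
proof -
  have uniq: "u' = u" if "of_int (snd (quotient_of r)) * u' = 1" for u'
  proof -
    let ?b = "of_int (snd (quotient_of r)) :: 'a"
    have "u' = u' * (?b * u)" using assms by simp
    also have "\<dots> = (?b * u') * u" by (simp only: mult.assoc mult.commute mult.left_commute)
    also have "\<dots> = u" using that by simp
    finally show ?thesis .
  qed
  have "(THE u'. of_int (snd (quotient_of r)) * u' = 1) = u"
    by (rule the_equality, rule assms, erule uniq)
  then show ?thesis by (simp only: rat_scalar_def)
qed

lemma rat_scalar_of_int: "rat_scalar (of_int n) = (of_int n :: 'a::comm_ring_1)"
  using rat_scalar_eqI[of "of_int n" "1::'a"] by simp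

lemma rat_scalar_of_rat: "rat_scalar r = (of_rat r :: 'a::field_char_0)"
proof -
  obtain a b where ab: "quotient_of r = (a, b)" by (cases "quotient_of r")
  have b: "b > 0" and r: "r = of_int a / of_int b"
    using quotient_of_denom_pos[OF ab] quotient_of_div[OF ab] by auto
  have "rat_scalar r = (of_int a * inverse (of_int b) :: 'a)"
    using rat_scalar_eqI[of r "inverse (of_int b) :: 'a"] ab b by simp
  also have "\<dots> = of_rat r"
    unfolding r of_rat_divide of_rat_of_int_eq by (simp only: divide_inverse)
  finally show ?thesis .
qed

end

theory Submission
  imports Defs "HOL-Library.Disjoint_Sets"
begin

text \<open>
  Write \<open>Z(g)\<close> for the centralizer. Multiply the weighted cardinality of the orbiquotient by the
  order of the group, and distribute this factor over the conjugacy classes \<open>c\<close> with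
  representative \<open>g\<close> as \<open>|G| = |c| |Z(g)|\<close>. By the weighted Burnside lemma, \<open>|Z(g)|\<close> times the
  weighted number of \<open>Z(g)\<close>-orbits on the fixed points of \<open>g\<close> is the sum, over \<open>h\<close> in \<open>Z(g)\<close>, of
  the weights of the points fixed by both \<open>g\<close> and \<open>h\<close> (\<open>weighted_card_orbiquotient\<close>).

  A map \<open>\<alpha>\<close> from \<open>{1..m}\<close> to \<open>X\<close> is fixed by \<open>g\<close> and \<open>h\<close> exactly if it is constant on the cycles
  of both, that is, on the blocks of the join of their cycle partitions. Its value can be chosen
  freely on each block, and the sum of the weights over all choices factors into one power sum
  of \<open>f\<close> over \<open>X\<close> for each block, with the size of the block as exponent (\<open>sum_fixed_by_pair\<close>).
  This is the monomial of the orbicycle index belonging to the pair, evaluated at the power sums.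

  So the identity multiplied by the order of the group holds in every commutative ring, with integer
  coefficients only. If the order is invertible in the ring, it can be cancelled; for this,
  evaluating a polynomial must commute with dividing its coefficients by the order
  (\<open>mp_eval_common_denominator\<close>).
\<close>

section \<open>Orbits counted with weights\<close>

text \<open>Both sides count pairs of a group element and a point fixed by it, each with the weight of
  the point. Counted by points, an orbit contributes its weight times the sum of the orders of its
  stabilizers, which is the order of the group by the orbit-stabilizer theorem.\<close>
lemma (in group_action) weighted_burnside:
  fixes w :: "'c \<Rightarrow> 'w::comm_semiring_1"
  assumes "finite (carrier G)" "finite E"
    and w_inv: "\<And>g x. g \<in> carrier G \<Longrightarrow> x \<in> E \<Longrightarrow> w (\<phi> g x) = w x"
  shows "of_nat (order G) * (\<Sum>C\<in>orbits G E \<phi>. w (SOME x. x \<in> C)) =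
         (\<Sum>g\<in>carrier G. \<Sum>x\<in>invariants E \<phi> g. w x)"
proof -
  have orbit_sum: "(\<Sum>x\<in>C. of_nat (card (stabilizer G \<phi> x)) * w x) = of_nat (order G) * w (SOME x. x \<in> C)"
    if C: "C \<in> orbits G E \<phi>" for C
  proof -
    obtain x0 where x0: "x0 \<in> E" "C = Group_Action.orbit G \<phi> x0"
      using C by (auto simp: orbits_def)
    have w_C: "w x = w x0" if "x \<in> C" for x
      using that x0 w_inv by (auto simp: Group_Action.orbit_def)
    have "x0 \<in> C" using x0 orbit_refl by simp
    then have "(SOME x. x \<in> C) \<in> C" by (rule someI)
    then have "w (SOME x. x \<in> C) = w x0" by (rule w_C)
    moreover have "(\<Sum>x\<in>C. of_nat (card (stabilizer G \<phi> x)) * w x) =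
        of_nat (\<Sum>x\<in>C. card (stabilizer G \<phi> x)) * w x0"
      by (simp add: w_C sum_distrib_right)
    ultimately show ?thesis
      by (simp only: card_stablizer_sum[OF assms(1) C])
  qed
  have "(\<Sum>g\<in>carrier G. \<Sum>x\<in>invariants E \<phi> g. w x) =
        (\<Sum>g\<in>carrier G. \<Sum>x\<in>E. if \<phi> g x = x then w x else 0)"
    unfolding invariants_def by (rule sum.cong[OF refl], rule sum.inter_filter[OF assms(2)])
  also have "\<dots> = (\<Sum>x\<in>E. \<Sum>g\<in>carrier G. if \<phi> g x = x then w x else 0)"
    by (rule sum.swap)
  also have "\<dots> = (\<Sum>x\<in>E. of_nat (card (stabilizer G \<phi> x)) * w x)"
    by (intro sum.cong refl)
       (simp add: stabilizer_def sum.inter_filter[symmetric] assms(1))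
  also have "\<dots> = (\<Sum>C\<in>orbits G E \<phi>. \<Sum>x\<in>C. of_nat (card (stabilizer G \<phi> x)) * w x)"
    by (rule disjoint_sum[OF assms(2), symmetric])
  also have "\<dots> = of_nat (order G) * (\<Sum>C\<in>orbits G E \<phi>. w (SOME x. x \<in> C))"
    by (simp add: orbit_sum sum_distrib_left)
  finally show ?thesis by simp
qed

text \<open>A \<^locale>\<open>group_action\<close> acts by extensional bijections of the set, which an action
  given by a formula, such as permuting coordinates, does not satisfy. Restricting each map to the
  set makes the locale available; orbits and fixed points do not notice the difference.\<close>
lemma group_action_restrict:
  fixes G (structure)
  assumes "group G"
    and closed: "\<And>g x. g \<in> carrier G \<Longrightarrow> x \<in> E \<Longrightarrow> \<phi> g x \<in> E"
    and one: "\<And>x. x \<in> E \<Longrightarrow> \<phi> \<one> x = x"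
    and mult: "\<And>g h x. g \<in> carrier G \<Longrightarrow> h \<in> carrier G \<Longrightarrow> x \<in> E \<Longrightarrow>
      \<phi> (g \<otimes> h) x = \<phi> g (\<phi> h x)"
  shows "group_action G E (\<lambda>g. restrict (\<phi> g) E)"
proof -
  interpret group G by fact
  have bij: "bij_betw (\<phi> g) E E" if g: "g \<in> carrier G" for g
  proof (rule bij_betw_byWitness[where f' = "\<phi> (inv g)"])
    show "\<forall>x\<in>E. \<phi> (inv g) (\<phi> g x) = x" "\<forall>x\<in>E. \<phi> g (\<phi> (inv g) x) = x"
      using g by (simp_all add: mult[symmetric] one)
  qed (use g closed in auto)
  show ?thesis
  proof (intro group_action.intro group_hom.intro group_hom_axioms.intro homI)
    show "restrict (\<phi> g) E \<in> carrier (BijGroup E)" if "g \<in> carrier G" for g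
      using bij[OF that] by (simp add: BijGroup_def Bij_def)
    show "restrict (\<phi> (g \<otimes> h)) E = restrict (\<phi> g) E \<otimes>\<^bsub>BijGroup E\<^esub> restrict (\<phi> h) E"
      if "g \<in> carrier G" "h \<in> carrier G" for g h
      using that bij[of g] bij[of h] closed
      by (auto simp: BijGroup_def Bij_def compose_def mult fun_eq_iff)
  qed (auto simp: group_BijGroup assms)
qed

lemma weighted_burnside_unrestricted:
  fixes G (structure) and w :: "'b \<Rightarrow> 'w::comm_semiring_1"
  assumes "group G" "finite (carrier G)" "finite E"
    and "\<And>g x. g \<in> carrier G \<Longrightarrow> x \<in> E \<Longrightarrow> \<phi> g x \<in> E"
    and "\<And>x. x \<in> E \<Longrightarrow> \<phi> \<one> x = x"
    and "\<And>g h x. g \<in> carrier G \<Longrightarrow> h \<in> carrier G \<Longrightarrow> x \<in> E \<Longrightarrow>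
      \<phi> (g \<otimes> h) x = \<phi> g (\<phi> h x)"
    and "\<And>g x. g \<in> carrier G \<Longrightarrow> x \<in> E \<Longrightarrow> w (\<phi> g x) = w x"
  shows "of_nat (order G) * (\<Sum>C\<in>orbits G E \<phi>. w (SOME x. x \<in> C)) =
         (\<Sum>g\<in>carrier G. \<Sum>x\<in>invariants E \<phi> g. w x)"
proof -
  let ?\<psi> = "\<lambda>g. restrict (\<phi> g) E"
  interpret group_action G E ?\<psi>
    by (rule group_action_restrict) (use assms in auto)
  have "orbits G E ?\<psi> = orbits G E \<phi>"
  proof -
    have "Group_Action.orbit G ?\<psi> x = Group_Action.orbit G \<phi> x" if "x \<in> E" for x
      using that by (simp add: Group_Action.orbit_def)
    then show ?thesis by (auto simp: orbits_def)
  qed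
  moreover have "invariants E ?\<psi> g = invariants E \<phi> g" for g
    by (auto simp: invariants_def)
  ultimately show ?thesis
    using weighted_burnside[of w] assms by simp
qed

lemma (in group) stabilizer_conjugation:
  assumes "g \<in> carrier G"
  shows "stabilizer G (\<lambda>h. \<lambda>x\<in>carrier G. h \<otimes> x \<otimes> inv h) g = centralizer G g"
proof -
  have "h \<otimes> g \<otimes> inv h = g \<longleftrightarrow> h \<otimes> g = g \<otimes> h" if "h \<in> carrier G" for h
    using assms that inv_solve_right'[of g "h \<otimes> g" h] by auto
  then show ?thesis using assms by (auto simp: stabilizer_def centralizer_def)
qed

lemma (in group) subgroup_centralizer:
  assumes "g \<in> carrier G"
  shows "subgroup (centralizer G g) G"
  using group_action.stabilizer_subgroup[OF action_by_conjugation assms]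
  by (simp add: stabilizer_conjugation assms)

lemma (in group) conj_classes_eq:
  "conj_classes G = orbits G (carrier G) (\<lambda>h. \<lambda>x\<in>carrier G. h \<otimes> x \<otimes> inv h)"
proof -
  have "Group_Action.orbit G (\<lambda>h x. h \<otimes> x \<otimes> inv h) g =
      Group_Action.orbit G (\<lambda>h. \<lambda>x\<in>carrier G. h \<otimes> x \<otimes> inv h) g" if "g \<in> carrier G" for g
    using that by (simp add: Group_Action.orbit_def)
  then show ?thesis by (auto simp: conj_classes_def orbits_def)
qed

lemma (in group) Union_conj_classes: "\<Union>(conj_classes G) = carrier G"
  unfolding conj_classes_eq
  by (rule group_action.orbits_coverture[OF action_by_conjugation])

text \<open>The orbit-stabilizer theorem for the action of the group on itself by conjugation.\<close>
lemma (in group) card_conj_class_mult_card_centralizer: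
  assumes "c \<in> conj_classes G" "g \<in> c"
  shows "card c * card (centralizer G g) = order G"
proof -
  let ?\<kappa> = "\<lambda>h. \<lambda>x\<in>carrier G. h \<otimes> x \<otimes> inv h"
  interpret K: group_action G "carrier G" ?\<kappa> by (rule action_by_conjugation)
  have g: "g \<in> carrier G" using assms Union_conj_classes by auto
  have "Group_Action.orbit G ?\<kappa> g \<in> orbits G (carrier G) ?\<kappa>"
    using g by (auto simp: orbits_def)
  then have "c = Group_Action.orbit G ?\<kappa> g"
    using K.disjoint_union[of c "Group_Action.orbit G ?\<kappa> g"] K.orbit_refl[OF g] assms
    by (auto simp: conj_classes_eq)
  then show ?thesis
    using K.orbit_stabilizer_theorem[OF g] g by (simp add: stabilizer_conjugation)
qed

text \<open>The centralizer of \<open>g\<close> acts on the fixed points of \<open>g\<close>, so the weighted Burnside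
  lemma turns the part of the orbiquotient over the class of \<open>g\<close> into a sum over pairs of
  commuting elements. It needs the factor \<open>|Z(g)|\<close>, and splitting the order of the group as
  \<open>|c| |Z(g)|\<close> provides it, with the coefficient \<open>|c|\<close> of the orbicycle index left over.\<close>
lemma (in group) weighted_card_orbiquotient:
  fixes w :: "'y \<Rightarrow> 'w::comm_ring_1"
  assumes fin: "finite (carrier G)" "finite Y"
    and rep: "class_reps G rep"
    and closed: "\<And>g y. g \<in> carrier G \<Longrightarrow> y \<in> Y \<Longrightarrow> \<phi> g y \<in> Y"
    and one: "\<And>y. y \<in> Y \<Longrightarrow> \<phi> \<one> y = y"
    and mult: "\<And>g h y. g \<in> carrier G \<Longrightarrow> h \<in> carrier G \<Longrightarrow> y \<in> Y \<Longrightarrow>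
      \<phi> (g \<otimes> h) y = \<phi> g (\<phi> h y)"
    and w_inv: "\<And>g y. g \<in> carrier G \<Longrightarrow> y \<in> Y \<Longrightarrow> w (\<phi> g y) = w y"
  shows "of_nat (order G) * weighted_card (orbiquotient G rep Y \<phi>) (orbit_weight w) =
    (\<Sum>(c, h)\<in>class_pairs G rep. of_nat (card c) *
      (\<Sum>y\<in>invariants Y \<phi> (rep c) \<inter> invariants Y \<phi> h. w y))"
proof -
  let ?Z = "\<lambda>c. G\<lparr>carrier := centralizer G (rep c)\<rparr>"
  have fin_classes: "finite (conj_classes G)"
    using fin Union_conj_classes by (simp add: finite_UnionD)
  have rep_c: "rep c \<in> c" "rep c \<in> carrier G" if "c \<in> conj_classes G" for c
    using rep that Union_conj_classes by (auto simp: class_reps_def)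
  have sub_Z: "centralizer G g \<subseteq> carrier G" for g by (auto simp: centralizer_def)
  have fin_Z: "finite (centralizer G g)" for g
    using sub_Z fin(1) by (rule finite_subset)
  have fin_inv: "finite (invariants Y \<phi> g)" for g
    using fin(2) by (simp add: invariants_def)
  have class_sum: "of_nat (order G) * (\<Sum>C\<in>orbits (?Z c) (invariants Y \<phi> (rep c)) \<phi>. w (SOME y. y \<in> C)) =
      of_nat (card c) * (\<Sum>h\<in>centralizer G (rep c).
        \<Sum>y\<in>invariants Y \<phi> (rep c) \<inter> invariants Y \<phi> h. w y)"
    if c: "c \<in> conj_classes G" for c
  proof -
    let ?g = "rep c" and ?I = "invariants Y \<phi> (rep c)"
    have g: "?g \<in> carrier G" by (rule rep_c(2)[OF c])
    have stable: "\<phi> h y \<in> ?I" if h: "h \<in> centralizer G ?g" and y: "y \<in> ?I" for h y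
    proof -
      have "\<phi> ?g (\<phi> h y) = \<phi> (?g \<otimes> h) y"
        using h y g by (simp add: mult centralizer_def invariants_def)
      also have "\<dots> = \<phi> (h \<otimes> ?g) y" using h by (simp add: centralizer_def)
      also have "\<dots> = \<phi> h y"
        using mult[of h ?g y] h y g sub_Z by (auto simp: invariants_def)
      finally show ?thesis
        using h y closed by (simp add: centralizer_def invariants_def)
    qed
    have "of_nat (order (?Z c)) * (\<Sum>C\<in>orbits (?Z c) ?I \<phi>. w (SOME y. y \<in> C)) =
        (\<Sum>h\<in>carrier (?Z c). \<Sum>y\<in>invariants ?I \<phi> h. w y)"
    proof (rule weighted_burnside_unrestricted)
      show "group (?Z c)" using subgroup_centralizer[OF g] by (rule subgroup_imp_group)
      show "\<phi> (h \<otimes>\<^bsub>?Z c\<^esub> h') y = \<phi> h (\<phi> h' y)"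
        if "h \<in> carrier (?Z c)" "h' \<in> carrier (?Z c)" "y \<in> ?I" for h h' y
        using that mult[of h h' y] sub_Z by (auto simp: invariants_def)
    qed (use fin_Z fin_inv stable one w_inv sub_Z[of ?g] in \<open>auto simp: invariants_def\<close>)
    moreover have "invariants ?I \<phi> h = ?I \<inter> invariants Y \<phi> h" for h
      by (auto simp: invariants_def)
    moreover have "order G = card c * order (?Z c)"
      using card_conj_class_mult_card_centralizer[OF c rep_c(1)[OF c]] by (simp add: order_def)
    ultimately show ?thesis by (simp add: mult.assoc)
  qed
  have "weighted_card (orbiquotient G rep Y \<phi>) (orbit_weight w) =
      (\<Sum>c\<in>conj_classes G. \<Sum>C\<in>orbits (?Z c) (invariants Y \<phi> (rep c)) \<phi>. w (SOME y. y \<in> C))"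
    unfolding weighted_card_def orbiquotient_def
    by (subst sum.Sigma) (auto simp: fin_classes fin_inv orbits_def orbit_weight_def split_beta)
  then have "of_nat (order G) * weighted_card (orbiquotient G rep Y \<phi>) (orbit_weight w) =
      (\<Sum>c\<in>conj_classes G. \<Sum>h\<in>centralizer G (rep c). of_nat (card c) *
        (\<Sum>y\<in>invariants Y \<phi> (rep c) \<inter> invariants Y \<phi> h. w y))"
    by (simp add: sum_distrib_left class_sum[unfolded sum_distrib_left])
  then show ?thesis
    unfolding class_pairs_def by (subst sum.Sigma[symmetric]) (auto simp: fin_classes fin_Z)
qed

lemma finite_class_pairs:
  assumes "group G" "finite (carrier G)"
  shows "finite (class_pairs G rep)"
proof -
  have "finite (conj_classes G)"
    using assms group.Union_conj_classes[of G] by (simp add: finite_UnionD)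
  moreover have "finite (centralizer G g)" for g
    using assms(2) by (simp add: centralizer_def)
  ultimately show ?thesis by (simp add: class_pairs_def)
qed

section \<open>Functions constant on the blocks of a partition\<close>

text \<open>The reflexive transitive closure in the join relates every element of the type to itself.
  On the ground set \<open>S\<close>, which it preserves, it restricts to an equivalence relation with the
  same classes.\<close>
lemma partition_on_partition_join:
  assumes "\<Union>\<pi> \<union> \<Union>\<rho> = S"
  shows "partition_on S (partition_join \<pi> \<rho>)"
proof -
  let ?r = "same_block \<pi> \<union> same_block \<rho>"
  have "?r \<subseteq> S \<times> S" using assms by (auto simp: same_block_def)
  then have "?r `` S \<subseteq> S" by auto
  then have "?r\<^sup>* `` S = S" by (rule Image_closed_trancl)
  then have closed: "y \<in> S" if "(x, y) \<in> ?r\<^sup>*" "x \<in> S" for x y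
    using that by auto
  have "sym ?r" by (auto simp: same_block_def sym_def)
  then have "sym (?r\<^sup>*)" by (rule sym_rtrancl)
  then have "equiv S (?r\<^sup>* \<inter> S \<times> S)"
    by (auto intro!: equivI refl_onI symI transI dest: symD intro: rtrancl_trans)
  moreover have "partition_join \<pi> \<rho> = S // (?r\<^sup>* \<inter> S \<times> S)"
    unfolding partition_join_def quotient_def assms using closed by auto
  ultimately show ?thesis by (simp add: partition_on_quotient)
qed

definition block_constant :: "'i set set \<Rightarrow> ('i \<Rightarrow> 'x) \<Rightarrow> bool" where
  "block_constant \<pi> \<alpha> \<longleftrightarrow> (\<forall>B\<in>\<pi>. \<forall>i\<in>B. \<forall>j\<in>B. \<alpha> i = \<alpha> j)"

text \<open>Being constant propagates along chains of overlapping blocks; this is what makes the join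
  the right partition for points fixed by two permutations at once.\<close>
lemma block_constant_partition_join:
  "block_constant (partition_join \<pi> \<rho>) \<alpha> \<longleftrightarrow> block_constant \<pi> \<alpha> \<and> block_constant \<rho> \<alpha>"
proof
  let ?r = "same_block \<pi> \<union> same_block \<rho>"
  assume join: "block_constant (partition_join \<pi> \<rho>) \<alpha>"
  have "\<alpha> i = \<alpha> j" if B: "B \<in> \<pi> \<union> \<rho>" "i \<in> B" "j \<in> B" for B i j
  proof -
    have "?r\<^sup>* `` {i} \<in> partition_join \<pi> \<rho>"
      unfolding partition_join_def by (rule quotientI) (use B in auto)
    moreover have "i \<in> ?r\<^sup>* `` {i}" "j \<in> ?r\<^sup>* `` {i}"
      using B by (auto simp: same_block_def intro!: r_into_rtrancl)
    ultimately show ?thesis using join unfolding block_constant_def by blast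
  qed
  then show "block_constant \<pi> \<alpha> \<and> block_constant \<rho> \<alpha>"
    unfolding block_constant_def by blast
next
  let ?r = "same_block \<pi> \<union> same_block \<rho>"
  assume const: "block_constant \<pi> \<alpha> \<and> block_constant \<rho> \<alpha>"
  have eq: "\<alpha> j = \<alpha> i" if "(i, j) \<in> ?r\<^sup>*" for i j
    using that
  proof (induction rule: rtrancl_induct)
    case (step j k)
    then obtain B where "B \<in> \<pi> \<union> \<rho>" "j \<in> B" "k \<in> B"
      by (auto simp: same_block_def)
    then have "\<alpha> k = \<alpha> j" using const unfolding block_constant_def by blast
    with step.IH show ?case by simp
  qed simp
  show "block_constant (partition_join \<pi> \<rho>) \<alpha>"
    unfolding block_constant_def
  proof (intro ballI)
    fix B i j assume B: "B \<in> partition_join \<pi> \<rho>" "i \<in> B" "j \<in> B"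
    from B(1) obtain x where "B = ?r\<^sup>* `` {x}"
      unfolding partition_join_def by (rule quotientE)
    then have "\<alpha> i = \<alpha> x" "\<alpha> j = \<alpha> x" using B eq by blast+
    then show "\<alpha> i = \<alpha> j" by simp
  qed
qed

text \<open>A block-constant function chooses one value for each block independently, and a block of size
  \<open>k\<close> with value \<open>x\<close> contributes \<open>f x ^ k\<close> to the product. Distributivity then gives a product
  over the blocks of power sums.\<close>
lemma sum_block_constant:
  fixes f :: "'x \<Rightarrow> 'a::comm_ring_1"
  assumes S: "finite S" and P: "partition_on S P" and X: "finite X"
  shows "(\<Sum>\<alpha> | \<alpha> \<in> S \<rightarrow>\<^sub>E X \<and> block_constant P \<alpha>. \<Prod>i\<in>S. f (\<alpha> i)) =
         (\<Prod>B\<in>P. \<Sum>x\<in>X. f x ^ card B)"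
proof -
  \<comment> \<open>Precomposition with \<open>blk\<close> is the bijection from the choices of a value for each block to the
      block-constant functions.\<close>
  define blk where "blk i = (THE B. B \<in> P \<and> i \<in> B)" for i
  have blk_eq: "blk i = B" if "B \<in> P" "i \<in> B" for B i
    unfolding blk_def using that partition_onD2[OF P]
    by (intro the_equality) (auto simp: disjoint_def)
  have S_eq: "S = \<Union>P" by (rule partition_onD1[OF P])
  have blk: "blk i \<in> P" "i \<in> blk i" if "i \<in> S" for i
    using that blk_eq by (auto simp: S_eq)
  have ne: "B \<noteq> {}" if "B \<in> P" for B using that partition_onD3[OF P] by auto
  have some: "(SOME i. i \<in> B) \<in> B" if "B \<in> P" for B
    using ne[OF that] by (simp add: some_in_eq)
  have "(\<Prod>B\<in>P. \<Sum>x\<in>X. f x ^ card B) = (\<Sum>\<beta>\<in>P \<rightarrow>\<^sub>E X. \<Prod>B\<in>P. f (\<beta> B) ^ card B)"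
    by (rule prod_sum_PiE) (use finite_elements[OF S P] X in auto)
  also have "\<dots> = (\<Sum>\<alpha> | \<alpha> \<in> S \<rightarrow>\<^sub>E X \<and> block_constant P \<alpha>. \<Prod>i\<in>S. f (\<alpha> i))"
  proof (rule sum.reindex_bij_witness[where
        i = "\<lambda>\<alpha>. \<lambda>B\<in>P. \<alpha> (SOME i. i \<in> B)" and j = "\<lambda>\<beta>. \<lambda>i\<in>S. \<beta> (blk i)"])
    fix \<beta> assume \<beta>: "\<beta> \<in> P \<rightarrow>\<^sub>E X"
    show "(\<lambda>B\<in>P. (\<lambda>i\<in>S. \<beta> (blk i)) (SOME i. i \<in> B)) = \<beta>"
    proof (rule extensionalityI[of _ P])
      fix B assume B: "B \<in> P"
      then have "(SOME i. i \<in> B) \<in> S" "blk (SOME i. i \<in> B) = B"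
        using some[OF B] blk_eq by (auto simp: S_eq)
      then show "(\<lambda>B\<in>P. (\<lambda>i\<in>S. \<beta> (blk i)) (SOME i. i \<in> B)) B = \<beta> B"
        using B by simp
    qed (use \<beta> in \<open>auto simp: PiE_def\<close>)
    have "block_constant P (\<lambda>i\<in>S. \<beta> (blk i))"
      using blk_eq by (auto simp: block_constant_def S_eq)
    then show "(\<lambda>i\<in>S. \<beta> (blk i)) \<in> {\<alpha>. \<alpha> \<in> S \<rightarrow>\<^sub>E X \<and> block_constant P \<alpha>}"
      using \<beta> blk by auto
    have "(\<Prod>i\<in>S. f ((\<lambda>i\<in>S. \<beta> (blk i)) i)) = (\<Prod>B\<in>P. \<Prod>i\<in>B. f (\<beta> (blk i)))"
      using prod.partition[OF S P, of "\<lambda>i. f (\<beta> (blk i))"] by simp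
    also have "\<dots> = (\<Prod>B\<in>P. f (\<beta> B) ^ card B)"
      by (intro prod.cong refl) (simp add: blk_eq)
    finally show "(\<Prod>i\<in>S. f ((\<lambda>i\<in>S. \<beta> (blk i)) i)) = (\<Prod>B\<in>P. f (\<beta> B) ^ card B)" .
  next
    fix \<alpha> assume "\<alpha> \<in> {\<alpha>. \<alpha> \<in> S \<rightarrow>\<^sub>E X \<and> block_constant P \<alpha>}"
    then have \<alpha>: "\<alpha> \<in> S \<rightarrow>\<^sub>E X" "block_constant P \<alpha>" by auto
    show "(\<lambda>i\<in>S. (\<lambda>B\<in>P. \<alpha> (SOME i. i \<in> B)) (blk i)) = \<alpha>"
    proof (rule extensionalityI[of _ S])
      fix i assume i: "i \<in> S"
      have "\<alpha> (SOME j. j \<in> blk i) = \<alpha> i"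
        using \<alpha>(2) blk[OF i] some[OF blk(1)[OF i]] unfolding block_constant_def by blast
      then show "(\<lambda>i\<in>S. (\<lambda>B\<in>P. \<alpha> (SOME i. i \<in> B)) (blk i)) i = \<alpha> i"
        using i blk by simp
    qed (use \<alpha> in \<open>auto simp: PiE_def\<close>)
    show "(\<lambda>B\<in>P. \<alpha> (SOME i. i \<in> B)) \<in> P \<rightarrow>\<^sub>E X"
      using \<alpha>(1) some by (fastforce simp: S_eq PiE_iff)
  qed
  finally show ?thesis by simp
qed

lemma prod_blocks_by_size:
  fixes v :: "nat \<Rightarrow> 'a::comm_monoid_mult"
  assumes P: "partition_on {1..m} P"
  shows "(\<Prod>B\<in>P. v (card B)) = (\<Prod>k\<in>{1..m}. v k ^ blocks_of_size k P)"
proof -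
  have fin: "finite P" by (rule finite_elements[OF _ P]) simp
  have "card B \<in> {1..m}" if B: "B \<in> P" for B
  proof -
    have "B \<subseteq> {1..m}" "B \<noteq> {}" using B P by (auto simp: partition_on_def)
    then show ?thesis
      using card_mono[of "{1..m}" B] finite_subset[of B "{1..m}"]
      by (auto simp: Suc_le_eq card_gt_0_iff)
  qed
  then have "(\<Prod>B\<in>P. v (card B)) = (\<Prod>k\<in>{1..m}. \<Prod>B | B \<in> P \<and> card B = k. v (card B))"
    by (intro prod.group[symmetric]) (auto simp: fin)
  also have "\<dots> = (\<Prod>k\<in>{1..m}. v k ^ blocks_of_size k P)"
    by (intro prod.cong refl) (simp add: blocks_of_size_def)
  finally show ?thesis .
qed

section \<open>Permutations of the coordinates of a power\<close>

lemma group_perm_group: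
  assumes "subgroup G (sym_group m)"
  shows "group (perm_group m G)"
  unfolding perm_group_def using sym_group_is_group assms by (rule group.subgroup_imp_group)

lemma perm_group_simps [simp]:
  "carrier (perm_group m G) = G"
  "g \<otimes>\<^bsub>perm_group m G\<^esub> h = g \<circ> h"
  "\<one>\<^bsub>perm_group m G\<^esub> = id"
  by (simp_all add: perm_group_def sym_group_def)

lemma coord_action_in_power_set:
  assumes g: "g permutes {1..m}" and \<alpha>: "\<alpha> \<in> power_set X m"
  shows "coord_action g \<alpha> \<in> power_set X m"
proof -
  note inv = permutes_inv[OF g]
  show ?thesis unfolding power_set_def
  proof (rule PiE_I)
    fix i assume "i \<in> {1..m}"
    then have "inv' g i \<in> {1..m}" using permutes_in_image[OF inv] by blast
    then show "coord_action g \<alpha> i \<in> X" using \<alpha> by (auto simp: coord_action_def power_set_def)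
  next
    fix i assume i: "i \<notin> {1..m}"
    then have "coord_action g \<alpha> i = \<alpha> i" 
      using permutes_not_in[OF inv] by (simp add: coord_action_def)
    then show "coord_action g \<alpha> i = undefined"
      using PiE_arb[OF \<alpha>[unfolded power_set_def] i] by simp
  qed
qed

lemma coord_action_comp:
  assumes "g permutes S" "h permutes S"
  shows "coord_action (g \<circ> h) \<alpha> = coord_action g (coord_action h \<alpha>)"
  using o_inv_distrib[OF permutes_bij[OF assms(1)] permutes_bij[OF assms(2)]]
  by (simp add: coord_action_def comp_assoc)

lemma power_weight_coord_action:
  assumes "g permutes {1..m}"
  shows "power_weight m f (coord_action g \<alpha>) = power_weight m f \<alpha>"
  using prod.permute[OF permutes_inv[OF assms], of "\<lambda>i. f (\<alpha> i)"]
  by (simp add: power_weight_def coord_action_def comp_def)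

lemma Union_cycle_partition:
  assumes "g permutes {1..m}"
  shows "\<Union>(cycle_partition m g) = {1..m}"
proof -
  have "permutation g" using assms by (auto simp: permutation_permutes)
  then show ?thesis
    using permutes_orbit_subset[OF assms] permutation_self_in_orbit[of g]
    by (fastforce simp: cycle_partition_def)
qed

lemma coord_action_fixed_iff:
  assumes g: "g permutes {1..m}" and \<alpha>: "\<alpha> \<in> extensional {1..m}"
  shows "coord_action g \<alpha> = \<alpha> \<longleftrightarrow> block_constant (cycle_partition m g) \<alpha>"
proof
  assume "coord_action g \<alpha> = \<alpha>"
  then have step: "\<alpha> (g i) = \<alpha> i" for i
    by (metis comp_apply coord_action_def g permutes_inverses(2))
  have "\<alpha> j = \<alpha> i" if "j \<in> Orbits.orbit g i" for i j
    using that by (induction rule: Orbits.orbit.induct) (simp_all add: step)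
  then show "block_constant (cycle_partition m g) \<alpha>"
    by (fastforce simp: block_constant_def cycle_partition_def)
next
  assume const: "block_constant (cycle_partition m g) \<alpha>"
  have perm: "permutation g" using g by (auto simp: permutation_permutes)
  have "\<alpha> (inv' g i) = \<alpha> i" for i
  proof (cases "i \<in> {1..m}")
    case True
    then have "inv' g i \<in> {1..m}" using permutes_in_image[OF permutes_inv[OF g]] by blast
    then have "Orbits.orbit g (inv' g i) \<in> cycle_partition m g"
      by (simp add: cycle_partition_def)
    moreover have "inv' g i \<in> Orbits.orbit g (inv' g i)"
      by (rule permutation_self_in_orbit[OF perm])
    moreover have "i \<in> Orbits.orbit g (inv' g i)"
      using permutes_inverses(1)[OF g] by (metis Orbits.orbit.base)
    ultimately show ?thesis using const unfolding block_constant_def by blast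
  next
    case False
    then show ?thesis using permutes_not_in[OF permutes_inv[OF g]] by simp
  qed
  then show "coord_action g \<alpha> = \<alpha>" by (auto simp: coord_action_def)
qed

text \<open>A point fixed by both permutations is a function constant on the cycles of each, hence on the
  blocks of the join of the two cycle partitions.\<close>
lemma sum_fixed_by_pair:
  fixes f :: "'x \<Rightarrow> 'a::comm_ring_1"
  assumes X: "finite X" and g: "g permutes {1..m}" and h: "h permutes {1..m}"
  shows "(\<Sum>\<alpha>\<in>invariants (power_set X m) coord_action g \<inter> invariants (power_set X m) coord_action h.
           power_weight m f \<alpha>) =
         (\<Prod>k\<in>{1..m}. weighted_card X (\<lambda>x. f x ^ k) ^
           blocks_of_size k (partition_join (cycle_partition m g) (cycle_partition m h)))"
proof -
  let ?P = "partition_join (cycle_partition m g) (cycle_partition m h)"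
  have P: "partition_on {1..m} ?P"
    by (rule partition_on_partition_join)
       (simp only: Union_cycle_partition[OF g] Union_cycle_partition[OF h] Un_absorb)
  have "invariants (power_set X m) coord_action g \<inter> invariants (power_set X m) coord_action h =
      {\<alpha>. \<alpha> \<in> {1..m} \<rightarrow>\<^sub>E X \<and> block_constant ?P \<alpha>}"
    by (auto simp: invariants_def power_set_def PiE_def block_constant_partition_join
        coord_action_fixed_iff[OF g] coord_action_fixed_iff[OF h])
  then have "(\<Sum>\<alpha>\<in>invariants (power_set X m) coord_action g \<inter> invariants (power_set X m) coord_action h.
      power_weight m f \<alpha>) = (\<Prod>B\<in>?P. weighted_card X (\<lambda>x. f x ^ card B))"
    using sum_block_constant[OF _ P X, of f] by (simp add: power_weight_def weighted_card_def)
  also have "\<dots> = (\<Prod>k\<in>{1..m}. weighted_card X (\<lambda>x. f x ^ k) ^ blocks_of_size k ?P)"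
    by (rule prod_blocks_by_size[OF P])
  finally show ?thesis .
qed

section \<open>Evaluation of polynomials with a common denominator\<close>

text \<open>The scalar is defined through lowest terms, where the denominator may be smaller than
  \<open>d\<close>. It still divides \<open>d\<close>, so it is invertible as well, and the cofactor cancels.\<close>
lemma rat_scalar_divide:
  fixes u :: "'a::comm_ring_1"
  assumes d: "d > 0" and u: "of_nat d * u = 1"
  shows "rat_scalar (of_nat n / of_nat d) = of_nat n * u"
proof -
  obtain a b where ab: "quotient_of (of_nat n / of_nat d) = (a, b)"
    by (cases "quotient_of (of_nat n / of_nat d)")
  have b: "b > 0" by (rule quotient_of_denom_pos[OF ab])
  have "of_nat n / of_nat d = (of_int a / of_int b :: rat)" by (rule quotient_of_div[OF ab])
  then have "(of_int (int n * b) :: rat) = of_int (a * int d)"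
    using b d by (simp add: field_simps)
  then have eq: "int n * b = a * int d" by (simp only: of_int_eq_iff)
  then have "b dvd a * int d" by (metis dvd_triv_right)
  then have "b dvd int d"
    using quotient_of_coprime[OF ab] by (simp add: coprime_dvd_mult_right_iff coprime_commute)
  then obtain q where q: "int d = b * q" ..
  with eq b have n: "int n = a * q" by simp
  have d': "of_int b * of_int q = (of_nat d :: 'a)"
    by (metis of_int_mult of_int_of_nat_eq q)
  have n': "of_int a * of_int q = (of_nat n :: 'a)"
    by (metis of_int_mult of_int_of_nat_eq n)
  have "rat_scalar (of_nat n / of_nat d) = of_int a * (of_int q * u)"
    using rat_scalar_eqI[of "of_nat n / of_nat d" "of_int q * u"] ab d' u
    by (simp add: mult.assoc[symmetric])
  then show ?thesis by (simp add: mult.assoc[symmetric] n')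
qed

definition monomial_eval :: "(nat \<Rightarrow>\<^sub>0 nat) \<Rightarrow> (nat \<Rightarrow> 'a::comm_ring_1) \<Rightarrow> 'a" where
  "monomial_eval e v = (\<Prod>k\<in>Poly_Mapping.keys e. v k ^ Poly_Mapping.lookup e k)"

text \<open>Evaluation is not additive in general, because \<^const>\<open>rat_scalar\<close> is unspecified on rationals
  whose denominator is not invertible. It is linear on the polynomials whose coefficients have
  a fixed invertible denominator \<open>d\<close>. Both evaluations in the theorem are of this kind: \<open>d\<close> is
  the order of the group for the orbicycle index, and \<open>1\<close> for its multiple by that order. The
  exponents \<open>e i\<close> may repeat, so each coefficient collects the terms with equal exponents.\<close>
lemma mp_eval_common_denominator:
  fixes v :: "nat \<Rightarrow> 'a::comm_ring_1"
  assumes I: "finite I" and d: "d > 0" and u: "of_nat d * u = (1::'a)"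
  shows "mp_eval (mp_const (1 / of_nat d) * (\<Sum>i\<in>I. Poly_Mapping.single (e i) (of_nat (n i)))) v =
         u * (\<Sum>i\<in>I. of_nat (n i) * monomial_eval (e i) v)"
proof -
  let ?p = "mp_const (1 / of_nat d) * (\<Sum>i\<in>I. Poly_Mapping.single (e i) (of_nat (n i)))"
  define N where "N x = (\<Sum>i | i \<in> I \<and> e i = x. n i)" for x
  have p: "?p = (\<Sum>i\<in>I. Poly_Mapping.single (e i) (of_nat (n i) / of_nat d))"
    by (simp add: mp_const_def sum_distrib_left mult_single)
  have "Poly_Mapping.lookup ?p x = (\<Sum>i\<in>I. if e i = x then of_nat (n i) / of_nat d else 0)" for x
    unfolding p lookup_sum by (intro sum.cong refl) (simp add: lookup_single when_def)
  then have lookup: "Poly_Mapping.lookup ?p x = of_nat (N x) / of_nat d" for x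
    by (simp add: N_def sum.inter_filter[symmetric] I sum_divide_distrib)
  then have coeff: "rat_scalar (Poly_Mapping.lookup ?p x) = of_nat (N x) * u" for x
    by (simp add: rat_scalar_divide[OF d u])
  \<comment> \<open>An exponent that is not a key has coefficient zero, so the sum may run over all \<open>e i\<close>.\<close>
  have keys: "Poly_Mapping.keys ?p \<subseteq> e ` I"
  proof
    fix x assume "x \<in> Poly_Mapping.keys ?p"
    then have "N x \<noteq> 0" using lookup[of x] by (auto simp: in_keys_iff)
    then obtain i where "i \<in> {i. i \<in> I \<and> e i = x}" unfolding N_def by (meson sum.neutral)
    then show "x \<in> e ` I" by auto
  qed
  have "mp_eval ?p v = (\<Sum>x\<in>Poly_Mapping.keys ?p. of_nat (N x) * u * monomial_eval x v)"
    unfolding mp_eval_def coeff monomial_eval_def ..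
  also have "\<dots> = (\<Sum>x\<in>e ` I. of_nat (N x) * u * monomial_eval x v)"
  proof (rule sum.mono_neutral_left)
    show "\<forall>x\<in>e ` I - Poly_Mapping.keys ?p. of_nat (N x) * u * monomial_eval x v = 0"
      using lookup d by (auto simp: in_keys_iff)
  qed (use I keys in auto)
  also have "\<dots> = (\<Sum>x\<in>e ` I. \<Sum>i | i \<in> I \<and> e i = x. of_nat (n i) * u * monomial_eval (e i) v)"
    by (intro sum.cong refl) (simp add: N_def sum_distrib_right)
  also have "\<dots> = (\<Sum>i\<in>I. of_nat (n i) * u * monomial_eval (e i) v)"
    by (rule sum.image_gen[OF I, symmetric])
  also have "\<dots> = u * (\<Sum>i\<in>I. of_nat (n i) * monomial_eval (e i) v)"
    by (simp add: sum_distrib_left mult.assoc mult.left_commute)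
  finally show ?thesis .
qed

lemma mp_var_power: "mp_var k ^ n = Poly_Mapping.single (Poly_Mapping.single k n) 1"
  by (induction n) (simp_all add: mp_var_def mult_single single_add[symmetric])

lemma prod_mp_var_power:
  assumes "finite K"
  shows "(\<Prod>k\<in>K. mp_var k ^ b k) =
    Poly_Mapping.single (\<Sum>k\<in>K. Poly_Mapping.single k (b k)) 1"
  using assms by (induction rule: finite_induct) (simp_all add: mp_var_power mult_single)

lemma monomial_eval_sum_single:
  fixes v :: "nat \<Rightarrow> 'a::comm_ring_1"
  assumes "finite K"
  shows "monomial_eval (\<Sum>k\<in>K. Poly_Mapping.single k (b k)) v = (\<Prod>k\<in>K. v k ^ b k)"
proof -
  let ?e = "\<Sum>k\<in>K. Poly_Mapping.single k (b k)"
  have lookup: "Poly_Mapping.lookup ?e k = (if k \<in> K then b k else 0)" for k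
    using assms by (simp add: lookup_sum lookup_single when_def)
  have "monomial_eval ?e v = (\<Prod>k\<in>K. v k ^ Poly_Mapping.lookup ?e k)"
    unfolding monomial_eval_def
    by (rule prod.mono_neutral_left) (use assms lookup in \<open>auto simp: in_keys_iff split: if_splits\<close>)
  then show ?thesis by (simp add: lookup)
qed

section \<open>The weighted cardinality of the orbiquotient of a power\<close>

theorem theorem4:
  fixes X :: "'x set" and f :: "'x \<Rightarrow> 'a::comm_ring_1"
    and m :: nat and G :: "(nat \<Rightarrow> nat) set"
    and rep :: "(nat \<Rightarrow> nat) set \<Rightarrow> (nat \<Rightarrow> nat)"
  assumes "finite X"
    and "subgroup G (sym_group m)"
    and "class_reps (perm_group m G) rep"
  shows "(of_nat (card G) dvd (1::'a) \<longrightarrow>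
            weighted_card (orbiquotient (perm_group m G) rep (power_set X m) coord_action)
              (orbit_weight (power_weight m f))
            = mp_eval (orbicycle_index m G rep) (\<lambda>k. weighted_card X (\<lambda>x. f x ^ k)))
         \<and> of_nat (card G) *
             weighted_card (orbiquotient (perm_group m G) rep (power_set X m) coord_action)
               (orbit_weight (power_weight m f))
           = mp_eval (of_nat (card G) * orbicycle_index m G rep)
               (\<lambda>k. weighted_card X (\<lambda>x. f x ^ k))"
proof -
  let ?G = "perm_group m G"
  let ?v = "\<lambda>k. weighted_card X (\<lambda>x. f x ^ k)"
  let ?J = "\<lambda>c h. partition_join (cycle_partition m (rep c)) (cycle_partition m h)"
  let ?lhs = "weighted_card (orbiquotient ?G rep (power_set X m) coord_action)
    (orbit_weight (power_weight m f))"
  \<comment> \<open>Distinct pairs may have the same exponent, so the polynomial is kept as a sum over pairs.\<close>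
  define e where "e = (\<lambda>(c, h). \<Sum>k\<in>{1..m}. Poly_Mapping.single k (blocks_of_size k (?J c h)))"
  let ?Q = "\<Sum>i\<in>class_pairs ?G rep. Poly_Mapping.single (e i) (of_nat (card (fst i))) :: rat_mpoly"
  interpret group ?G by (rule group_perm_group) fact
  have perm: "g permutes {1..m}" if "g \<in> G" for g
    using subgroup.subset[OF assms(2)] that by (auto simp: sym_group_def)
  have "G \<subseteq> {p. p permutes {1..m}}" using perm by auto
  then have fin_G: "finite G" by (rule finite_subset) (simp add: finite_permutations)
  have "id \<in> G" using one_closed by simp
  then have card_G: "card G > 0" using fin_G by (auto simp: card_gt_0_iff)
  have fin_pairs: "finite (class_pairs ?G rep)"
    by (rule finite_class_pairs) (simp_all add: is_group fin_G)
  have pairs: "rep c \<in> G" "h \<in> G" if "(c, h) \<in> class_pairs ?G rep" for c h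
    using that Union_conj_classes assms(3)
    by (auto simp: class_pairs_def centralizer_def class_reps_def)
  have Q: "(\<Sum>(c, h)\<in>class_pairs ?G rep. of_nat (card c) *
      (\<Prod>k\<in>{1..m}. mp_var k ^ blocks_of_size k (?J c h))) = ?Q"
    by (intro sum.cong refl)
       (auto simp: e_def prod_mp_var_power mult_single simp flip: single_of_nat)
  \<comment> \<open>Any invertible denominator is allowed: \<open>card G\<close> gives the unscaled identity, \<open>1\<close> the scaled one.\<close>
  have eval: "mp_eval (mp_const (1 / of_nat d) * ?Q) ?v = u * (of_nat (card G) * ?lhs)"
    if "d > 0" "of_nat d * u = 1" for d u
  proof -
    have "of_nat (card G) * ?lhs = (\<Sum>(c, h)\<in>class_pairs ?G rep. of_nat (card c) *
        (\<Sum>\<alpha>\<in>invariants (power_set X m) coord_action (rep c) \<inter>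
              invariants (power_set X m) coord_action h. power_weight m f \<alpha>))"
      unfolding order_def[of ?G, simplified, symmetric]
    proof (rule weighted_card_orbiquotient)
      show "finite (power_set X m)" using assms(1) by (simp add: power_set_def finite_PiE)
      show "coord_action (g \<otimes>\<^bsub>?G\<^esub> h) \<alpha> = coord_action g (coord_action h \<alpha>)"
        if "g \<in> carrier ?G" "h \<in> carrier ?G" for g h and \<alpha> :: "nat \<Rightarrow> 'x"
        using that by (simp add: coord_action_comp[OF perm perm])
      show "coord_action g \<alpha> \<in> power_set X m"
        if "g \<in> carrier ?G" "\<alpha> \<in> power_set X m" for g \<alpha>
        using that by (simp add: coord_action_in_power_set[OF perm])
      show "power_weight m f (coord_action g \<alpha>) = power_weight m f \<alpha>"
        if "g \<in> carrier ?G" for g \<alpha>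
        using that by (simp add: power_weight_coord_action[OF perm])
    qed (use assms(3) fin_G in \<open>simp_all add: coord_action_def\<close>)
    also have "\<dots> = (\<Sum>i\<in>class_pairs ?G rep. of_nat (card (fst i)) * monomial_eval (e i) ?v)"
    proof (intro sum.cong refl, clarify)
      fix c h assume ch: "(c, h) \<in> class_pairs ?G rep"
      show "of_nat (card c) *
          (\<Sum>\<alpha>\<in>invariants (power_set X m) coord_action (rep c) \<inter>
                invariants (power_set X m) coord_action h. power_weight m f \<alpha>) =
          of_nat (card (fst (c, h))) * monomial_eval (e (c, h)) ?v"
        unfolding sum_fixed_by_pair[OF assms(1) perm[OF pairs(1)[OF ch]] perm[OF pairs(2)[OF ch]]]
        by (simp add: e_def monomial_eval_sum_single)
    qed
    finally show ?thesis
      by (simp add: mp_eval_common_denominator[OF fin_pairs that])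
  qed
  have index: "orbicycle_index m G rep = mp_const (1 / of_nat (card G)) * ?Q"
    by (simp only: orbicycle_index_def Q)
  have "of_nat (card G) * orbicycle_index m G rep = mp_const (1 / of_nat 1) * ?Q"
    using card_G unfolding index mult.assoc[symmetric]
    by (simp add: mp_const_def mult_single flip: single_of_nat)
  then have scaled: "mp_eval (of_nat (card G) * orbicycle_index m G rep) ?v = of_nat (card G) * ?lhs"
    using eval[of 1 1] by simp
  have "?lhs = mp_eval (orbicycle_index m G rep) ?v" if "of_nat (card G) dvd (1::'a)"
  proof -
    obtain u :: 'a where u: "of_nat (card G) * u = 1"
      using \<open>of_nat (card G) dvd 1\<close> by (metis dvdE)
    have "mp_eval (orbicycle_index m G rep) ?v = (of_nat (card G) * u) * ?lhs"
      using eval[OF card_G u] by (simp add: index ac_simps)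
    then show ?thesis by (simp add: u)
  qed
  with scaled show ?thesis by simp
qed

end
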